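(* Let $E$ be a normed space, let $f\colon E\to E$, and let $p\in[1,+\infty)$. Assume that the composition operator $C_f$ maps $c_0(E)$ into $bv_p(E)$. Then $C_f\colon c_0(E)\to bv_p(E)$ is locally uniformly continuous if and only if $f$ is a constant map.
   Context: $E$ is a normed space over $\mathbb R$ or $\mathbb C$ with norm $\|\cdot\|$. For a map $f\colon E\to E$, the composition operator $C_f$ assigns to a sequence $x\colon\mathbb N\to E$ the sequence $C_f(x)$ with $C_f(x)(n)=f(x(n))$ for all $n\in\mathbb N$. $c_0(E)$ is the space of all $E$-valued sequences converging to $0$, with norm $\|x\|_\infty=\sup_n\|x(n)\|$. $bv_p(E)$ is the space of all sequences $x\colon\mathbb N\to E$ with $\sum_{n=1}^\infty\|x(n+1)-x(n)\|^p<+\infty$, with norm $\|x\|_{bv_p}=\|x(1)\|+\bigl(\sum_{n=1}^\infty\|x(n+1)-x(n)\|^p\bigr)^{1/p}$. A map between normed spaces is called locally uniformly continuous if it is uniformly continuous on every bounded subset of its domain. *)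

theory Defs
  imports "HOL-Analysis.Analysis"
begin

text \<open>
  Sequences are functions \<open>nat \<Rightarrow> 'a\<close>; the index set starts at \<open>0\<close>, so the first
  term of \<open>x\<close> is \<open>x 0\<close>.
\<close>

definition composition_op :: "('a \<Rightarrow> 'a) \<Rightarrow> (nat \<Rightarrow> 'a) \<Rightarrow> (nat \<Rightarrow> 'a)"
  where "composition_op f x = (\<lambda>n. f (x n))"

definition c0 :: "(nat \<Rightarrow> 'a::real_normed_vector) set"
  where "c0 = {x. x \<longlonglongrightarrow> 0}"

definition sup_norm :: "(nat \<Rightarrow> 'a::real_normed_vector) \<Rightarrow> real"
  where "sup_norm x = (SUP n. norm (x n))"

definition bv :: "real \<Rightarrow> (nat \<Rightarrow> 'a::real_normed_vector) set"
  where "bv p = {x. summable (\<lambda>n. norm (x (Suc n) - x n) powr p)}"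

definition bv_norm :: "real \<Rightarrow> (nat \<Rightarrow> 'a::real_normed_vector) \<Rightarrow> real"
  where "bv_norm p x = norm (x 0) + (\<Sum>n. norm (x (Suc n) - x n) powr p) powr (1 / p)"

text \<open>
  The metric induced by a norm \<open>N\<close> on a sequence space \<open>V\<close>. A distance function has
  to be nonnegative on the whole type, while \<open>N\<close> is meaningful only on \<open>V\<close>; hence
  the value \<open>0\<close> off the carrier.
\<close>

definition seq_metric ::
  "(nat \<Rightarrow> 'a::real_normed_vector) set \<Rightarrow> ((nat \<Rightarrow> 'a) \<Rightarrow> real) \<Rightarrow> (nat \<Rightarrow> 'a) metric"
  where "seq_metric V N =
    metric (V, \<lambda>x y. if x \<in> V \<and> y \<in> V then N (\<lambda>n. x n - y n) else 0)"

definition c0_metric :: "(nat \<Rightarrow> 'a::real_normed_vector) metric"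
  where "c0_metric = seq_metric c0 sup_norm"

definition bv_metric :: "real \<Rightarrow> (nat \<Rightarrow> 'a::real_normed_vector) metric"
  where "bv_metric p = seq_metric (bv p) (bv_norm p)"

definition locally_uniformly_continuous_map ::
  "'a metric \<Rightarrow> 'b metric \<Rightarrow> ('a \<Rightarrow> 'b) \<Rightarrow> bool"
  where "locally_uniformly_continuous_map m1 m2 F \<longleftrightarrow>
    F \<in> mspace m1 \<rightarrow> mspace m2 \<and>
    (\<forall>B. Metric_space.mbounded (mspace m1) (mdist m1) B
      \<longrightarrow> uniformly_continuous_map (submetric m1 B) m2 F)"


text \<open>
  The constructor \<open>metric\<close> is meaningful only for genuine metrics, so we verify that
  the two spaces are normed spaces.
\<close>

lemma Metric_space_seq:
  fixes V :: "(nat \<Rightarrow> 'a::real_normed_vector) set"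
  assumes diff: "\<And>x y. x \<in> V \<Longrightarrow> y \<in> V \<Longrightarrow> (\<lambda>n. x n - y n) \<in> V"
    and nonneg: "\<And>x. x \<in> V \<Longrightarrow> 0 \<le> N x"
    and zero: "\<And>x. x \<in> V \<Longrightarrow> N x = 0 \<longleftrightarrow> x = (\<lambda>n. 0)"
    and minus: "\<And>x. x \<in> V \<Longrightarrow> N (\<lambda>n. - x n) = N x"
    and add: "\<And>x y. x \<in> V \<Longrightarrow> y \<in> V \<Longrightarrow> N (\<lambda>n. x n + y n) \<le> N x + N y"
  shows "Metric_space V (\<lambda>x y. if x \<in> V \<and> y \<in> V then N (\<lambda>n. x n - y n) else 0)"
proof
  fix x y
  show "0 \<le> (if x \<in> V \<and> y \<in> V then N (\<lambda>n. x n - y n) else 0)"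
    by (simp add: nonneg diff)
  show "(if x \<in> V \<and> y \<in> V then N (\<lambda>n. x n - y n) else 0)
      = (if y \<in> V \<and> x \<in> V then N (\<lambda>n. y n - x n) else 0)"
    using minus[OF diff, of x y] by simp
next
  fix x y assume xy: "x \<in> V" "y \<in> V"
  show "((if x \<in> V \<and> y \<in> V then N (\<lambda>n. x n - y n) else 0) = 0) = (x = y)"
    using zero[OF diff[OF xy]] xy by (auto simp: fun_eq_iff)
next
  fix x y z assume "x \<in> V" "y \<in> V" "z \<in> V"
  then show "(if x \<in> V \<and> z \<in> V then N (\<lambda>n. x n - z n) else 0)
    \<le> (if x \<in> V \<and> y \<in> V then N (\<lambda>n. x n - y n) else 0)
      + (if y \<in> V \<and> z \<in> V then N (\<lambda>n. y n - z n) else 0)"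
    using add[OF diff diff, of x y y z] by simp
qed

lemma bdd_above_c0:
  assumes "x \<in> c0"
  shows "bdd_above (range (\<lambda>n. norm (x n)))"
proof -
  have "Bseq x"
    using assms convergent_imp_Bseq by (auto simp: c0_def convergent_def)
  then obtain K where "\<And>n. norm (x n) \<le> K"
    by (auto simp: Bseq_def)
  then show ?thesis
    by (intro bdd_aboveI[where M=K]) auto
qed

lemma Metric_space_c0:
  "Metric_space (c0 :: (nat \<Rightarrow> 'a::real_normed_vector) set)
    (\<lambda>x y. if x \<in> c0 \<and> y \<in> c0 then sup_norm (\<lambda>n. x n - y n) else 0)"
proof (rule Metric_space_seq)
  fix x y :: "nat \<Rightarrow> 'a"
  assume x: "x \<in> c0" and y: "y \<in> c0"
  show "(\<lambda>n. x n - y n) \<in> c0"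
    using tendsto_diff[of x 0 sequentially y 0] x y by (simp add: c0_def)
  have le: "norm (z n) \<le> sup_norm z" if "z \<in> c0" for n and z :: "nat \<Rightarrow> 'a"
    unfolding sup_norm_def by (intro cSUP_upper bdd_above_c0 that) simp
  show "0 \<le> sup_norm x"
    using order_trans[OF norm_ge_zero le[OF x]] .
  show "sup_norm x = 0 \<longleftrightarrow> x = (\<lambda>n. 0)"
  proof
    assume "sup_norm x = 0"
    with le[OF x] show "x = (\<lambda>n. 0)" by (auto simp: fun_eq_iff)
  qed (simp add: sup_norm_def)
  show "sup_norm (\<lambda>n. - x n) = sup_norm x"
    by (simp add: sup_norm_def)
  show "sup_norm (\<lambda>n. x n + y n) \<le> sup_norm x + sup_norm y"
    unfolding sup_norm_def[of "\<lambda>n. x n + y n"]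
    by (intro cSUP_least) (auto intro!: norm_triangle_le add_mono le x y)
qed

lemma mspace_c0_metric [simp]: "mspace c0_metric = c0"
  by (simp add: c0_metric_def seq_metric_def Metric_space.mspace_metric[OF Metric_space_c0])

lemma mdist_c0_metric:
  "x \<in> c0 \<Longrightarrow> y \<in> c0 \<Longrightarrow> mdist c0_metric x y = sup_norm (\<lambda>n. x n - y n)"
  by (simp add: c0_metric_def seq_metric_def Metric_space.mdist_metric[OF Metric_space_c0])

lemma powr_convex_nonneg:
  fixes s t u p :: real
  assumes p: "1 \<le> p" and "0 \<le> s" "0 \<le> t" and u: "0 \<le> u" "u \<le> 1"
  shows "((1 - u) * s + u * t) powr p \<le> (1 - u) * s powr p + u * t powr p"
proof -
  have scale: "(v * r) powr p \<le> v * r powr p" if "0 \<le> v" "v \<le> 1" "0 \<le> r" for v r :: real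
  proof -
    have "v powr p \<le> v powr 1"
      using that p by (intro powr_mono') auto
    then show ?thesis
      using that by (auto simp: powr_mult intro!: mult_right_mono)
  qed
  consider "s = 0" | "t = 0" | "0 < s" "0 < t"
    using assms by linarith
  then show ?thesis
  proof cases
    case 3
    then show ?thesis
      using convex_onD[OF powr_convex[OF p], of u s t] u by simp
  qed (use assms scale in auto)
qed

lemma Minkowski_series:
  fixes a b :: "nat \<Rightarrow> real"
  assumes p: "1 \<le> p" and a0: "\<And>n. 0 \<le> a n" and b0: "\<And>n. 0 \<le> b n"
    and a: "summable (\<lambda>n. a n powr p)" and b: "summable (\<lambda>n. b n powr p)"
  shows "summable (\<lambda>n. (a n + b n) powr p)"
    and "(\<Sum>n. (a n + b n) powr p) powr (1 / p)
      \<le> (\<Sum>n. a n powr p) powr (1 / p) + (\<Sum>n. b n powr p) powr (1 / p)"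
proof -
  define A where "A = (\<Sum>n. a n powr p) powr (1 / p)"
  define B where "B = (\<Sum>n. b n powr p) powr (1 / p)"
  have AB0: "0 \<le> A" "0 \<le> B" by (auto simp: A_def B_def)
  have Ap: "A powr p = (\<Sum>n. a n powr p)" and Bp: "B powr p = (\<Sum>n. b n powr p)"
    using p by (auto simp: A_def B_def powr_powr suminf_nonneg a b)
  have "summable (\<lambda>n. (a n + b n) powr p) \<and>
        (\<Sum>n. (a n + b n) powr p) powr (1 / p) \<le> A + B"
  proof (cases "A = 0 \<or> B = 0")
    case True
    then show ?thesis
    proof
      assume "A = 0"
      then have "(\<Sum>n. a n powr p) = 0" using Ap p by simp
      then have "a n = 0" for n
        using suminf_eq_zero_iff[OF a] by simp
      then show ?thesis using b by (simp add: B_def A_def)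
    next
      assume "B = 0"
      then have "(\<Sum>n. b n powr p) = 0" using Bp p by simp
      then have "b n = 0" for n
        using suminf_eq_zero_iff[OF b] by simp
      then show ?thesis using a by (simp add: B_def A_def)
    qed
  next
    case False
    with AB0 have A: "0 < A" and B: "0 < B" by auto
    define u where "u = B / (A + B)"
    define c where
      "c n = (A + B) powr p * ((1 - u) / A powr p * a n powr p + u / B powr p * b n powr p)" for n
    have u: "0 \<le> u" "u \<le> 1" and u': "1 - u = A / (A + B)"
      using A B by (auto simp: u_def field_simps)
    have le: "(a n + b n) powr p \<le> c n" for n
    proof -
      have eq: "a n + b n = (A + B) * ((1 - u) * (a n / A) + u * (b n / B))"
      proof -
        have "(A + B) * ((1 - u) * (a n / A)) = a n" "(A + B) * (u * (b n / B)) = b n"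
          unfolding u' using A B by (simp_all add: u_def)
        then show ?thesis by (simp add: distrib_left)
      qed
      have "(a n + b n) powr p = (A + B) powr p * ((1 - u) * (a n / A) + u * (b n / B)) powr p"
        unfolding eq using A B u a0 b0 by (intro powr_mult)
      also have "\<dots> \<le> (A + B) powr p * ((1 - u) * (a n / A) powr p + u * (b n / B) powr p)"
        using A B u a0 b0 p by (intro mult_left_mono powr_convex_nonneg) auto
      also have "\<dots> = c n"
        using A B a0 b0 by (simp add: c_def powr_divide)
      finally show ?thesis .
    qed
    have "(\<lambda>n. c n) sums ((A + B) powr p *
        ((1 - u) / A powr p * (\<Sum>n. a n powr p) + u / B powr p * (\<Sum>n. b n powr p)))"
      unfolding c_def by (intro sums_mult sums_add summable_sums a b)
    also have "(A + B) powr p *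
        ((1 - u) / A powr p * (\<Sum>n. a n powr p) + u / B powr p * (\<Sum>n. b n powr p))
        = (A + B) powr p"
      using A B by (simp flip: Ap Bp)
    finally have c: "c sums (A + B) powr p" .
    have s: "summable (\<lambda>n. (a n + b n) powr p)"
      using le by (intro summable_comparison_test_ev[OF _ sums_summable[OF c]]) simp
    have "(\<Sum>n. (a n + b n) powr p) \<le> (A + B) powr p"
      using suminf_le[OF le s sums_summable[OF c]] sums_unique[OF c] by simp
    then have "(\<Sum>n. (a n + b n) powr p) powr (1 / p) \<le> ((A + B) powr p) powr (1 / p)"
      using p by (intro powr_mono2) (auto intro: suminf_nonneg s)
    also have "\<dots> = A + B"
      using A B p by (simp add: powr_powr)
    finally show ?thesis using s by simp
  qed
  then show "summable (\<lambda>n. (a n + b n) powr p)"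
    and "(\<Sum>n. (a n + b n) powr p) powr (1 / p)
      \<le> (\<Sum>n. a n powr p) powr (1 / p) + (\<Sum>n. b n powr p) powr (1 / p)"
    by (auto simp: A_def B_def)
qed

lemma Metric_space_bv:
  assumes p: "1 \<le> p"
  shows "Metric_space (bv p :: (nat \<Rightarrow> 'a::real_normed_vector) set)
    (\<lambda>x y. if x \<in> bv p \<and> y \<in> bv p then bv_norm p (\<lambda>n. x n - y n) else 0)"
proof (rule Metric_space_seq)
  fix x y :: "nat \<Rightarrow> 'a"
  assume x: "x \<in> bv p" and y: "y \<in> bv p"
  note sx = x[unfolded bv_def, simplified] and sy = y[unfolded bv_def, simplified]
  note M = Minkowski_series[OF p norm_ge_zero norm_ge_zero sx sy]
  have le_diff: "norm (x (Suc n) - y (Suc n) - (x n - y n)) powr p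
      \<le> (norm (x (Suc n) - x n) + norm (y (Suc n) - y n)) powr p" for n
  proof (rule powr_mono2)
    have "x (Suc n) - y (Suc n) - (x n - y n) = (x (Suc n) - x n) - (y (Suc n) - y n)"
      by simp
    then show "norm (x (Suc n) - y (Suc n) - (x n - y n))
        \<le> norm (x (Suc n) - x n) + norm (y (Suc n) - y n)"
      by (metis norm_triangle_ineq4)
  qed (use p in auto)
  have le_add: "norm (x (Suc n) + y (Suc n) - (x n + y n)) powr p
      \<le> (norm (x (Suc n) - x n) + norm (y (Suc n) - y n)) powr p" for n
  proof (rule powr_mono2)
    show "norm (x (Suc n) + y (Suc n) - (x n + y n))
        \<le> norm (x (Suc n) - x n) + norm (y (Suc n) - y n)"
      by (metis add_diff_add norm_triangle_ineq)
  qed (use p in auto)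
  have s: "summable (\<lambda>n. norm (x (Suc n) + y (Suc n) - (x n + y n)) powr p)"
    using le_add by (intro summable_comparison_test_ev[OF _ M(1)]) simp
  show "(\<lambda>n. x n - y n) \<in> bv p"
    unfolding bv_def using le_diff by (auto intro: summable_comparison_test_ev[OF _ M(1)])
  show "0 \<le> bv_norm p x"
    by (simp add: bv_norm_def)
  show "bv_norm p x = 0 \<longleftrightarrow> x = (\<lambda>n. 0)"
  proof
    assume "bv_norm p x = 0"
    then have x0: "x 0 = 0" and "(\<Sum>n. norm (x (Suc n) - x n) powr p) powr (1 / p) = 0"
      unfolding bv_norm_def by (simp_all add: add_nonneg_eq_0_iff)
    then have "x (Suc n) = x n" for n
      using suminf_eq_zero_iff[OF sx] by simp
    then have "x n = 0" for n
      by (induction n) (simp_all add: x0)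
    then show "x = (\<lambda>n. 0)" by blast
  qed (simp add: bv_norm_def)
  show "bv_norm p (\<lambda>n. - x n) = bv_norm p x"
    by (simp add: bv_norm_def norm_minus_commute)
  have "(\<Sum>n. norm (x (Suc n) + y (Suc n) - (x n + y n)) powr p)
      \<le> (\<Sum>n. (norm (x (Suc n) - x n) + norm (y (Suc n) - y n)) powr p)"
    by (rule suminf_le[OF le_add s M(1)])
  then have "(\<Sum>n. norm (x (Suc n) + y (Suc n) - (x n + y n)) powr p) powr (1 / p)
      \<le> (\<Sum>n. (norm (x (Suc n) - x n) + norm (y (Suc n) - y n)) powr p) powr (1 / p)"
    using p by (intro powr_mono2) (auto intro: suminf_nonneg s)
  also note M(2)
  finally show "bv_norm p (\<lambda>n. x n + y n) \<le> bv_norm p x + bv_norm p y"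
    using norm_triangle_ineq[of "x 0" "y 0"] by (simp add: bv_norm_def)
qed

lemma mspace_bv_metric [simp]: "1 \<le> p \<Longrightarrow> mspace (bv_metric p) = bv p"
  by (simp add: bv_metric_def seq_metric_def Metric_space.mspace_metric[OF Metric_space_bv])

lemma mdist_bv_metric:
  "1 \<le> p \<Longrightarrow> x \<in> bv p \<Longrightarrow> y \<in> bv p
    \<Longrightarrow> mdist (bv_metric p) x y = bv_norm p (\<lambda>n. x n - y n)"
  by (simp add: bv_metric_def seq_metric_def Metric_space.mdist_metric[OF Metric_space_bv])

end

theory Submission
  imports Defs
begin

text \<open>
  If \<open>a\<close> and \<open>b\<close> are close but \<open>f a \<noteq> f b\<close>, compare the sequences \<open>a, 0, a, 0, \<dots>\<close> and
  \<open>b, 0, b, 0, \<dots>\<close>, both cut off after index \<open>N\<close>. Their sup-distance is \<open>norm (a - b)\<close>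
  for every \<open>N\<close>, while the \<open>p\<close>-variation of the difference of their images is at least
  \<open>N * norm (f a - f b) powr p\<close>. So local uniform continuity makes \<open>f\<close> locally constant,
  hence constant as \<open>E\<close> is connected.
\<close>

definition alternating :: "nat \<Rightarrow> 'a \<Rightarrow> nat \<Rightarrow> 'a::real_normed_vector"
  where "alternating N a n = (if even n \<and> n \<le> N then a else 0)"

lemma alternating_in_c0: "alternating N a \<in> c0"
proof -
  have "eventually (\<lambda>n. alternating N a n = 0) sequentially"
    using eventually_gt_at_top[of N] by eventually_elim (simp add: alternating_def)
  then show ?thesis
    by (simp add: c0_def tendsto_eventually)
qed

lemma mdist_alternating:
  "mdist c0_metric (alternating N a) (alternating N b) = norm (a - b)"
proof -
  have "(SUP n. norm (alternating N a n - alternating N b n)) = norm (a - b)"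
  proof (rule cSup_eq_maximum)
    \<comment> \<open>Index 0 is even and at most \<open>N\<close> whatever \<open>N\<close> is, so
      the supremum is attained there.\<close>
    show "norm (a - b) \<in> range (\<lambda>n. norm (alternating N a n - alternating N b n))"
      by (rule range_eqI[of _ _ 0]) (simp add: alternating_def)
  qed (auto simp: alternating_def)
  then show ?thesis
    by (simp add: mdist_c0_metric alternating_in_c0 sup_norm_def)
qed

text \<open>The bound \<open>R\<close> does not involve \<open>N\<close>, so a single modulus of
  continuity will serve all cut-offs at once.\<close>

lemma mbounded_alternating:
  "Metric_space.mbounded (mspace c0_metric) (mdist c0_metric)
    {alternating N a |N a. norm a \<le> R}"
proof -
  interpret Metric_space "mspace c0_metric" "mdist (c0_metric :: (nat \<Rightarrow> 'a) metric)"
    by (rule Metric_space_mspace_mdist)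
  have "alternating N a \<in> mcball (alternating 0 0) R" if "norm a \<le> R" for N and a :: 'a
  proof -
    \<comment> \<open>The centre is the zero sequence; writing it with the same \<open>N\<close>
      lets \<open>mdist_alternating\<close> compute the distance to it.\<close>
    have zero: "alternating 0 0 = (alternating N 0 :: nat \<Rightarrow> 'a)"
      by (auto simp: alternating_def)
    show ?thesis
      unfolding in_mcball zero using that
      by (simp add: mdist_alternating alternating_in_c0)
  qed
  then show ?thesis
    unfolding mbounded_def by blast
qed

text \<open>Both the tail of the series and the term \<open>norm (z 0)\<close> are dropped; taking
  \<open>p\<close>-th powers removes the root.\<close>

lemma sum_variation_le_bv_norm_powr:
  assumes p: "1 \<le> p" and z: "z \<in> bv p"
  shows "(\<Sum>n<N. norm (z (Suc n) - z n) powr p) \<le> bv_norm p z powr p"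
proof -
  let ?S = "\<Sum>n. norm (z (Suc n) - z n) powr p"
  have s: "summable (\<lambda>n. norm (z (Suc n) - z n) powr p)"
    using z by (simp add: bv_def)
  have "(\<Sum>n<N. norm (z (Suc n) - z n) powr p) \<le> ?S"
    using s by (intro sum_le_suminf) auto
  also have "\<dots> = (?S powr (1 / p)) powr p"
    using p s by (simp add: powr_powr suminf_nonneg)
  also have "\<dots> \<le> bv_norm p z powr p"
    using p by (intro powr_mono2) (auto simp: bv_norm_def)
  finally show ?thesis .
qed

lemma variation_alternating:
  fixes f :: "'a::real_normed_vector \<Rightarrow> 'a"
  assumes p: "1 \<le> p" and f: "composition_op f \<in> c0 \<rightarrow> bv p"
  shows "real N * norm (f a - f b) powr p
    \<le> mdist (bv_metric p) (composition_op f (alternating N a))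
        (composition_op f (alternating N b)) powr p"
proof -
  let ?x = "composition_op f (alternating N a)" and ?y = "composition_op f (alternating N b)"
  define z where "z = (\<lambda>n. ?x n - ?y n)"
  have x: "?x \<in> bv p" and y: "?y \<in> bv p"
    using f alternating_in_c0 by blast+
  \<comment> \<open>At odd indices and beyond \<open>N\<close> both images equal \<open>f 0\<close>,
    which cancels whatever its value.\<close>
  have zn: "z n = (if even n \<and> n \<le> N then f a - f b else 0)" for n
    by (simp add: z_def composition_op_def alternating_def)
  have "summable (\<lambda>n. norm (z (Suc n) - z n) powr p)"
    by (rule summable_finite[of "{..N}"]) (auto simp: zn)
  then have z: "z \<in> bv p"
    by (simp add: bv_def)
  have "real N * norm (f a - f b) powr p = (\<Sum>n<N. norm (z (Suc n) - z n) powr p)"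
  proof -
    \<comment> \<open>As \<open>Suc n\<close> is still at most \<open>N\<close>, exactly one of
      \<open>z n\<close> and \<open>z (Suc n)\<close> is \<open>f a - f b\<close> and the other is
      0.\<close>
    have "norm (z (Suc n) - z n) powr p = norm (f a - f b) powr p" if "n < N" for n
      using that by (cases "even n") (simp_all add: zn norm_minus_commute)
    then show ?thesis
      by simp
  qed
  also have "\<dots> \<le> bv_norm p z powr p"
    by (rule sum_variation_le_bv_norm_powr[OF p z])
  finally show ?thesis
    by (simp add: mdist_bv_metric[OF p x y] z_def)
qed

lemma locally_uniformly_continuous_imp_locally_constant:
  fixes f :: "'a::real_normed_vector \<Rightarrow> 'a"
  assumes p: "1 \<le> p" and f: "composition_op f \<in> c0 \<rightarrow> bv p"
    and luc: "locally_uniformly_continuous_map c0_metric (bv_metric p) (composition_op f)"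
  shows "eventually (\<lambda>b. f a = f b) (at a)"
proof -
  \<comment> \<open>The margin 1 in the radius leaves room for every \<open>b\<close> within
    distance 1 of \<open>a\<close>.\<close>
  define B :: "(nat \<Rightarrow> 'a) set" where "B = {alternating N b |N b. norm b \<le> norm a + 1}"
  have "uniformly_continuous_map (submetric c0_metric B) (bv_metric p) (composition_op f)"
    using luc mbounded_alternating
    unfolding locally_uniformly_continuous_map_def B_def by blast
  then obtain d where d: "0 < d"
    and close: "\<And>x y. \<lbrakk>x \<in> c0 \<inter> B; y \<in> c0 \<inter> B; mdist c0_metric y x < d\<rbrakk>
      \<Longrightarrow> mdist (bv_metric p) (composition_op f y) (composition_op f x) < 1"
    unfolding uniformly_continuous_map_def mspace_submetric mdist_submetric mspace_c0_metric
      Int_commute[of B] by (meson zero_less_one)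
  have "f a = f b" if b: "dist b a < min d 1" for b
  proof (rule ccontr)
    assume "f a \<noteq> f b"
    then have pos: "0 < norm (f a - f b) powr p"
      by simp
    \<comment> \<open>The radius \<open>d\<close> was fixed independently of \<open>N\<close>, so
      \<open>N\<close> may be chosen after \<open>b\<close>, by the Archimedean property.\<close>
    then obtain N where N: "1 < real N * norm (f a - f b) powr p"
      using ex_less_of_nat_mult by blast
    have "norm b \<le> norm a + 1"
      using b norm_triangle_sub[of b a] by (simp add: dist_norm)
    then have "alternating N b \<in> B" "alternating N a \<in> B"
      unfolding B_def by force+
    then have "mdist (bv_metric p) (composition_op f (alternating N a))
        (composition_op f (alternating N b)) < 1"
      using b by (intro close)
        (simp_all add: alternating_in_c0 mdist_alternating dist_norm norm_minus_commute)
    then have "mdist (bv_metric p) (composition_op f (alternating N a))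
        (composition_op f (alternating N b)) powr p \<le> 1"
      using p by (intro powr_le1) auto
    with variation_alternating[OF p f, of N a b] N show False
      by linarith
  qed
  then show ?thesis
    unfolding eventually_at using d by (intro exI[of _ "min d 1"]) auto
qed

theorem theorem15:
  fixes f :: "'a::real_normed_vector \<Rightarrow> 'a" and p :: real
  assumes "1 \<le> p"
    and "composition_op f \<in> c0 \<rightarrow> bv p"
  shows "locally_uniformly_continuous_map c0_metric (bv_metric p) (composition_op f)
    \<longleftrightarrow> f constant_on UNIV"
proof
  assume "locally_uniformly_continuous_map c0_metric (bv_metric p) (composition_op f)"
  then have "\<forall>a\<in>UNIV. eventually (\<lambda>b. f a = f b) (at a)"
    using locally_uniformly_continuous_imp_locally_constant[OF assms] by blast
  then have "f a = f 0" for a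
    \<comment> \<open>Local constancy at every point becomes global because the whole space is
      connected.\<close>
    using connected_local_const[OF connected_UNIV UNIV_I UNIV_I] by blast
  then show "f constant_on UNIV"
    by (auto simp: constant_on_def)
next
  assume "f constant_on UNIV"
  then obtain c where "\<And>a. f a = c"
    by (auto simp: constant_on_def)
  then have C: "composition_op f = (\<lambda>x n. c)"
    by (auto simp: composition_op_def)
  \<comment> \<open>For constant \<open>f\<close> the operator sends every sequence to this one
    element of \<open>bv p\<close>.\<close>
  have "(\<lambda>n. c) \<in> bv p"
    by (simp add: bv_def)
  then show "locally_uniformly_continuous_map c0_metric (bv_metric p) (composition_op f)"
    using assms(1) unfolding C
    by (auto simp: locally_uniformly_continuous_map_def uniformly_continuous_map_const)
qed

end
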